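(* $$\lim_{n\to\infty}\|\mathscr{A}_n\|\geq\frac{\pi^2}{8}.$$
   Context: For $n\in\mathbb{N}$, let $\mathbb{C}_2^s[Z_1,\ldots,Z_n]$ denote the complex vector space of all homogeneous polynomials of degree two in $n$ complex variables, each written uniquely as $p(z_1,\ldots,z_n)=\sum_{j,k=1}^n a_{jk}z_jz_k$ with $A_p=(a_{jk})$ a complex symmetric $n\times n$ matrix. Equip it with the norm $\|p\|_{\mathbb{D}^n,\infty}=\sup\{|p(z)|:z\in\mathbb{D}^n\}$, where $\mathbb{D}^n\subset\mathbb{C}^n$ is the unit polydisc. Let $M_n^s$ be the space of complex symmetric $n\times n$ matrices, equipped with the norm $\|A\|_{\infty\to1}=\sup\{|\langle Av,w\rangle|: v,w\in\mathbb{C}^n,\ \|v\|_{\ell^\infty(n)}\leq1,\ \|w\|_{\ell^\infty(n)}\leq1\}$. The linear map $\mathscr{A}_n:(\mathbb{C}_2^s[Z_1,\ldots,Z_n],\|\cdot\|_{\mathbb{D}^n,\infty})\to(M_n^s,\|\cdot\|_{\infty\to1})$ is defined by $\mathscr{A}_n(p)=A_p$, and $\|\mathscr{A}_n\|$ denotes its operator norm. *)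

theory Defs
  imports Jordan_Normal_Form.Matrix "HOL-Library.Poly_Mapping"
begin

text \<open>
  Complex polynomials in the variables \<open>Z\<^sub>0, Z\<^sub>1, \<dots>\<close> are elements of the monoid algebra over
  the finitely supported exponent vectors. Variables are indexed from \<open>0\<close>, in accordance with
  the indexing of vectors and matrices.
\<close>

type_synonym cpoly = "(nat \<Rightarrow>\<^sub>0 nat) \<Rightarrow>\<^sub>0 complex"

definition poly_eval :: "cpoly \<Rightarrow> complex vec \<Rightarrow> complex" where
  "poly_eval p z =
     (\<Sum>m\<in>Poly_Mapping.keys p. Poly_Mapping.lookup p m *
        (\<Prod>i\<in>Poly_Mapping.keys m. (z $ i) ^ Poly_Mapping.lookup m i))"

definition quadratic_polys :: "nat \<Rightarrow> cpoly set" where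
  "quadratic_polys n =
     {p. \<forall>m\<in>Poly_Mapping.keys p.
        Poly_Mapping.keys m \<subseteq> {..<n} \<and> (\<Sum>i\<in>Poly_Mapping.keys m. Poly_Mapping.lookup m i) = 2}"

definition polydisc :: "nat \<Rightarrow> complex vec set" where
  "polydisc n = {z \<in> carrier_vec n. \<forall>i<n. cmod (z $ i) < 1}"

definition polydisc_norm :: "nat \<Rightarrow> cpoly \<Rightarrow> real" where
  "polydisc_norm n p = (SUP z\<in>polydisc n. cmod (poly_eval p z))"

definition symmetric_mats :: "nat \<Rightarrow> complex mat set" where
  "symmetric_mats n = {A \<in> carrier_mat n n. transpose_mat A = A}"

text \<open>The inserted \<open>0\<close> only matters for the empty vector.\<close>

definition linf_norm :: "complex vec \<Rightarrow> real" where
  "linf_norm v = Max (insert 0 ((\<lambda>i. cmod (v $ i)) ` {..<dim_vec v}))"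

definition inf_one_norm :: "nat \<Rightarrow> complex mat \<Rightarrow> real" where
  "inf_one_norm n A =
     Sup {cmod ((A *\<^sub>v v) \<bullet>c w) | v w.
            v \<in> carrier_vec n \<and> w \<in> carrier_vec n \<and> linf_norm v \<le> 1 \<and> linf_norm w \<le> 1}"

definition sym_coeff_mat :: "nat \<Rightarrow> cpoly \<Rightarrow> complex mat" where
  "sym_coeff_mat n p =
     (THE A. A \<in> symmetric_mats n \<and>
        (\<forall>z\<in>carrier_vec n. poly_eval p z = (\<Sum>j<n. \<Sum>k<n. A $$ (j, k) * z $ j * z $ k)))"

text \<open>The suprema above and below are over nonempty bounded sets; see the lemmas at the end.\<close>

definition op_norm :: "'a set \<Rightarrow> ('a \<Rightarrow> real) \<Rightarrow> ('b \<Rightarrow> real) \<Rightarrow> ('a \<Rightarrow> 'b) \<Rightarrow> real" where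
  "op_norm V N N' T = (SUP x\<in>{x \<in> V. N x \<le> 1}. N' (T x))"

definition sym_coeff_norm :: "nat \<Rightarrow> real" where
  "sym_coeff_norm n =
     op_norm (quadratic_polys n) (polydisc_norm n) (inf_one_norm n) (sym_coeff_mat n)"

lemma degree_two_monomial:
  assumes "Poly_Mapping.keys m \<subseteq> {..<n}" and "(\<Sum>i\<in>Poly_Mapping.keys m. Poly_Mapping.lookup m i) = (2::nat)"
  obtains j k where "j < n" "k < n"
    "\<And>z :: complex vec. (\<Prod>i\<in>Poly_Mapping.keys m. (z $ i) ^ Poly_Mapping.lookup m i) = z $ j * z $ k"
proof -
  have fin: "finite (Poly_Mapping.keys m)" by simp
  have "Poly_Mapping.keys m \<noteq> {}" using assms(2) by auto
  then obtain j where j: "j \<in> Poly_Mapping.keys m" by blast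
  have s: "Poly_Mapping.lookup m j + (\<Sum>i\<in>Poly_Mapping.keys m - {j}. Poly_Mapping.lookup m i) = 2"
    using assms(2) sum.remove[OF fin j, of "Poly_Mapping.lookup m"] by simp
  have pos: "Poly_Mapping.lookup m i \<ge> 1" if "i \<in> Poly_Mapping.keys m" for i
    using that by (simp add: in_keys_iff Suc_le_eq)
  show ?thesis
  proof (cases "Poly_Mapping.keys m - {j} = {}")
    case True
    then have "Poly_Mapping.keys m = {j}" using j by auto
    then have "(\<Prod>i\<in>Poly_Mapping.keys m. (z $ i) ^ Poly_Mapping.lookup m i) = z $ j * z $ j" for z :: "complex vec"
      using s by (simp add: power2_eq_square)
    then show ?thesis using that j assms(1) by blast
  next
    case False
    then obtain k where k: "k \<in> Poly_Mapping.keys m - {j}" by blast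
    have t: "Poly_Mapping.lookup m j + (Poly_Mapping.lookup m k + (\<Sum>i\<in>Poly_Mapping.keys m - {j} - {k}. Poly_Mapping.lookup m i)) = 2"
      using s sum.remove[OF _ k, of "Poly_Mapping.lookup m"] fin by simp
    have "Poly_Mapping.lookup m k \<ge> 1" using k pos by blast
    then have jk: "Poly_Mapping.lookup m j = 1" "Poly_Mapping.lookup m k = 1" "(\<Sum>i\<in>Poly_Mapping.keys m - {j} - {k}. Poly_Mapping.lookup m i) = 0"
      using t pos[OF j] by linarith+
    have "\<forall>i\<in>Poly_Mapping.keys m - {j} - {k}. Poly_Mapping.lookup m i = 0"
      using jk(3) fin by (subst (asm) sum_eq_0_iff) auto
    then have "Poly_Mapping.keys m = {j, k}" using j k pos by fastforce
    then have "(\<Prod>i\<in>Poly_Mapping.keys m. (z $ i) ^ Poly_Mapping.lookup m i) = z $ j * z $ k" for z :: "complex vec"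
      using jk k by simp
    then show ?thesis using that j k assms(1) by blast
  qed
qed

lemma quadratic_monomial_mat:
  assumes "j < n" "k < n"
  shows "\<exists>A\<in>symmetric_mats n. \<forall>z. c * (z $ j * z $ k) =
    (\<Sum>i<n. \<Sum>l<n. A $$ (i, l) * z $ i * (z $ l :: complex))"
proof -
  define A where "A = mat n n (\<lambda>(i, l).
      (if i = j then (if l = k then c / 2 else 0) else 0) +
      (if i = k then (if l = j then c / 2 else 0) else 0))"
  have sym: "A \<in> symmetric_mats n"
    by (auto simp: A_def symmetric_mats_def intro!: eq_matI)
  have "c * (z $ j * z $ k) = (\<Sum>i<n. \<Sum>l<n. A $$ (i, l) * z $ i * (z $ l :: complex))" for z
  proof -
    have "(\<Sum>i<n. \<Sum>l<n. A $$ (i, l) * z $ i * z $ l) = (\<Sum>i<n. \<Sum>l<n.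
        (if l = k then (if i = j then c / 2 * z $ i * z $ l else 0) else 0) +
        (if l = j then (if i = k then c / 2 * z $ i * z $ l else 0) else 0))"
      by (intro sum.cong refl) (auto simp: A_def algebra_simps)
    also have "\<dots> = c * (z $ j * z $ k)"
      using assms by (simp add: sum.distrib sum.delta)
    finally show ?thesis by simp
  qed
  with sym show ?thesis by blast
qed

lemma sym_coeff_mat_exists:
  assumes "p \<in> quadratic_polys n"
  shows "\<exists>A\<in>symmetric_mats n. \<forall>z.
    poly_eval p z = (\<Sum>j<n. \<Sum>k<n. A $$ (j, k) * z $ j * z $ k)"
proof -
  have "\<exists>A\<in>symmetric_mats n. \<forall>z.
      (\<Sum>m\<in>S. Poly_Mapping.lookup p m * (\<Prod>i\<in>Poly_Mapping.keys m. (z $ i) ^ Poly_Mapping.lookup m i)) =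
      (\<Sum>j<n. \<Sum>k<n. A $$ (j, k) * z $ j * z $ k)"
    if "finite S" "S \<subseteq> Poly_Mapping.keys p" for S
    using that
  proof (induction S rule: finite_induct)
    case empty
    show ?case
      by (rule bexI[of _ "0\<^sub>m n n"]) (auto simp: symmetric_mats_def)
  next
    case (insert m S)
    then obtain A where A: "A \<in> symmetric_mats n"
      "\<And>z. (\<Sum>m\<in>S. Poly_Mapping.lookup p m * (\<Prod>i\<in>Poly_Mapping.keys m. (z $ i) ^ Poly_Mapping.lookup m i)) =
        (\<Sum>j<n. \<Sum>k<n. A $$ (j, k) * z $ j * z $ k)" by auto
    have "Poly_Mapping.keys m \<subseteq> {..<n}" "(\<Sum>i\<in>Poly_Mapping.keys m. Poly_Mapping.lookup m i) = 2"
      using assms insert.prems by (auto simp: quadratic_polys_def)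
    then obtain j k where jk: "j < n" "k < n"
      "\<And>z :: complex vec. (\<Prod>i\<in>Poly_Mapping.keys m. (z $ i) ^ Poly_Mapping.lookup m i) = z $ j * z $ k"
      using degree_two_monomial by blast
    obtain B where B: "B \<in> symmetric_mats n"
      "\<And>z. Poly_Mapping.lookup p m * (z $ j * z $ k) = (\<Sum>i<n. \<Sum>l<n. B $$ (i, l) * z $ i * z $ l)"
      using quadratic_monomial_mat[OF jk(1,2), of "Poly_Mapping.lookup p m"] by auto
    have AB: "A + B \<in> symmetric_mats n"
      using A(1) B(1) by (auto simp: symmetric_mats_def transpose_add)
    have cr: "A \<in> carrier_mat n n" "B \<in> carrier_mat n n"
      using A(1) B(1) by (auto simp: symmetric_mats_def)
    have "(\<Sum>j<n. \<Sum>k<n. (A + B) $$ (j, k) * z $ j * z $ k) =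
        (\<Sum>j<n. \<Sum>k<n. A $$ (j, k) * z $ j * z $ k) +
        (\<Sum>j<n. \<Sum>k<n. B $$ (j, k) * z $ j * z $ k)" for z
      unfolding sum.distrib[symmetric] using cr
      by (intro sum.cong refl) (auto simp: algebra_simps)
    then show ?case
      using AB A(2) B(2) jk(3) insert.hyps by (intro bexI[of _ "A + B"]) simp_all
  qed
  from this[of "Poly_Mapping.keys p"] show ?thesis by (simp add: poly_eval_def)
qed

lemma symmetric_form_unique:
  assumes A: "A \<in> symmetric_mats n" and B: "B \<in> symmetric_mats n"
    and eq: "\<And>z. z \<in> carrier_vec n \<Longrightarrow> (\<Sum>j<n. \<Sum>k<n. A $$ (j, k) * z $ j * z $ k) =
      (\<Sum>j<n. \<Sum>k<n. B $$ (j, k) * z $ j * z $ k)"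
  shows "A = B"
proof -
  have cr: "A \<in> carrier_mat n n" "B \<in> carrier_mat n n"
    using A B by (auto simp: symmetric_mats_def)
  have sym: "C $$ (k, l) = C $$ (l, k)" if "C \<in> symmetric_mats n" "k < n" "l < n" for C k l
  proof -
    have "C $$ (k, l) = transpose_mat C $$ (k, l)" using that by (simp add: symmetric_mats_def)
    also have "\<dots> = C $$ (l, k)"
      using that index_transpose_mat(1)[of k C l] by (auto simp: symmetric_mats_def)
    finally show ?thesis .
  qed
  have ev: "(\<Sum>i<n. \<Sum>j<n. C $$ (i, j) * vec n (\<lambda>i. (if i = k then a else 0) + (if i = l then b else 0)) $ i
      * vec n (\<lambda>i. (if i = k then a else 0) + (if i = l then b else 0)) $ j) =
      C $$ (k, k) * a * a + C $$ (k, l) * a * b + C $$ (l, k) * b * a + C $$ (l, l) * b * b"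
    if "k < n" "l < n" for C :: "complex mat" and k l a b
  proof -
    have "(\<Sum>i<n. \<Sum>j<n. C $$ (i, j) * vec n (\<lambda>i. (if i = k then a else 0) + (if i = l then b else 0)) $ i
      * vec n (\<lambda>i. (if i = k then a else 0) + (if i = l then b else 0)) $ j) =
      (\<Sum>i<n. \<Sum>j<n.
         (if j = k then (if i = k then C $$ (i, j) * a * a else 0) else 0)
       + (if j = l then (if i = k then C $$ (i, j) * a * b else 0) else 0)
       + (if j = k then (if i = l then C $$ (i, j) * b * a else 0) else 0)
       + (if j = l then (if i = l then C $$ (i, j) * b * b else 0) else 0))"
      by (intro sum.cong refl) (auto simp: algebra_simps)
    also have "\<dots> = C $$ (k, k) * a * a + C $$ (k, l) * a * b + C $$ (l, k) * b * a
        + C $$ (l, l) * b * b"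
      using that by (simp add: sum.distrib sum.delta)
    finally show ?thesis .
  qed
  have entries: "A $$ (k, l) = B $$ (k, l)" if "k < n" "l < n" for k l
  proof -
    have "A $$ (k, k) = B $$ (k, k)"
      using eq[of "vec n (\<lambda>i. (if i = k then 1 else 0) + (if i = l then 0 else 0))"]
        ev[OF that, of _ 1 0] by simp
    moreover have "A $$ (l, l) = B $$ (l, l)"
      using eq[of "vec n (\<lambda>i. (if i = k then 0 else 0) + (if i = l then 1 else 0))"]
        ev[OF that, of _ 0 1] by simp
    moreover have "A $$ (k, k) + A $$ (k, l) + A $$ (l, k) + A $$ (l, l) =
        B $$ (k, k) + B $$ (k, l) + B $$ (l, k) + B $$ (l, l)"
      using eq[of "vec n (\<lambda>i. (if i = k then 1 else 0) + (if i = l then 1 else 0))"]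
      unfolding ev[OF that, of _ 1 1] by simp
    ultimately show ?thesis
      using sym[OF A that] sym[OF B that] by simp
  qed
  show ?thesis by (rule eq_matI) (use cr entries in auto)
qed

lemma sym_coeff_mat:
  assumes "p \<in> quadratic_polys n"
  shows "sym_coeff_mat n p \<in> symmetric_mats n"
    and "\<And>z. z \<in> carrier_vec n \<Longrightarrow>
      poly_eval p z = (\<Sum>j<n. \<Sum>k<n. sym_coeff_mat n p $$ (j, k) * z $ j * z $ k)"
proof -
  have "\<exists>!A. A \<in> symmetric_mats n \<and>
        (\<forall>z\<in>carrier_vec n. poly_eval p z = (\<Sum>j<n. \<Sum>k<n. A $$ (j, k) * z $ j * z $ k))"
  proof (rule ex_ex1I)
    show "\<exists>A. A \<in> symmetric_mats n \<and>
        (\<forall>z\<in>carrier_vec n. poly_eval p z = (\<Sum>j<n. \<Sum>k<n. A $$ (j, k) * z $ j * z $ k))"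
      using sym_coeff_mat_exists[OF assms] by blast
  next
    fix A B
    assume *: "A \<in> symmetric_mats n \<and>
        (\<forall>z\<in>carrier_vec n. poly_eval p z = (\<Sum>j<n. \<Sum>k<n. A $$ (j, k) * z $ j * z $ k))"
      "B \<in> symmetric_mats n \<and>
        (\<forall>z\<in>carrier_vec n. poly_eval p z = (\<Sum>j<n. \<Sum>k<n. B $$ (j, k) * z $ j * z $ k))"
    show "A = B" by (rule symmetric_form_unique[of _ n]) (use * in auto)
  qed
  from theI'[OF this] show "sym_coeff_mat n p \<in> symmetric_mats n"
    and "\<And>z. z \<in> carrier_vec n \<Longrightarrow>
      poly_eval p z = (\<Sum>j<n. \<Sum>k<n. sym_coeff_mat n p $$ (j, k) * z $ j * z $ k)"
    unfolding sym_coeff_mat_def by blast+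
qed

lemma linf_norm_le_iff:
  assumes "v \<in> carrier_vec n" "0 \<le> r"
  shows "linf_norm v \<le> r \<longleftrightarrow> (\<forall>i<n. cmod (v $ i) \<le> r)"
  using assms by (auto simp: linf_norm_def)

lemma inner_mult_mat_vec:
  assumes "A \<in> carrier_mat n n" "v \<in> carrier_vec n" "w \<in> carrier_vec n"
  shows "(A *\<^sub>v v) \<bullet>c w = (\<Sum>j<n. \<Sum>k<n. A $$ (j, k) * v $ k * cnj (w $ j))"
  using assms
  by (auto simp: scalar_prod_def mult_mat_vec_def sum_distrib_right atLeast0LessThan
      intro!: sum.cong)

lemma polydisc_norm_bdd:
  assumes "p \<in> quadratic_polys n"
  shows "bdd_above ((\<lambda>z. cmod (poly_eval p z)) ` polydisc n)" "polydisc n \<noteq> {}"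
proof -
  let ?A = "sym_coeff_mat n p"
  have "cmod (poly_eval p z) \<le> (\<Sum>j<n. \<Sum>k<n. cmod (?A $$ (j, k)))" if "z \<in> polydisc n" for z
  proof -
    have z: "z \<in> carrier_vec n" "\<And>i. i < n \<Longrightarrow> cmod (z $ i) \<le> 1"
      using that by (auto simp: polydisc_def less_imp_le)
    show ?thesis unfolding sym_coeff_mat(2)[OF assms z(1)]
      by (intro sum_norm_le)
        (auto simp: norm_mult mult.assoc intro!: mult_left_le mult_le_one z)
  qed
  then show "bdd_above ((\<lambda>z. cmod (poly_eval p z)) ` polydisc n)" by (rule bdd_aboveI2)
  have "0\<^sub>v n \<in> polydisc n" by (auto simp: polydisc_def)
  then show "polydisc n \<noteq> {}" by blast
qed

lemma inf_one_norm_bdd: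
  assumes "A \<in> carrier_mat n n"
  shows "bdd_above {cmod ((A *\<^sub>v v) \<bullet>c w) | v w.
      v \<in> carrier_vec n \<and> w \<in> carrier_vec n \<and> linf_norm v \<le> 1 \<and> linf_norm w \<le> 1}"
    and "{cmod ((A *\<^sub>v v) \<bullet>c w) | v w.
      v \<in> carrier_vec n \<and> w \<in> carrier_vec n \<and> linf_norm v \<le> 1 \<and> linf_norm w \<le> 1} \<noteq> {}"
proof -
  have "cmod ((A *\<^sub>v v) \<bullet>c w) \<le> (\<Sum>j<n. \<Sum>k<n. cmod (A $$ (j, k)))"
    if vw: "v \<in> carrier_vec n" "w \<in> carrier_vec n" "linf_norm v \<le> 1" "linf_norm w \<le> 1" for v w
    unfolding inner_mult_mat_vec[OF assms vw(1,2)]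
    using vw linf_norm_le_iff[OF vw(1), of 1] linf_norm_le_iff[OF vw(2), of 1]
    by (intro sum_norm_le)
      (auto simp: norm_mult mult.assoc intro!: mult_left_le mult_le_one)
  then show "bdd_above {cmod ((A *\<^sub>v v) \<bullet>c w) | v w.
      v \<in> carrier_vec n \<and> w \<in> carrier_vec n \<and> linf_norm v \<le> 1 \<and> linf_norm w \<le> 1}"
    by (intro bdd_aboveI) auto
  have "linf_norm (0\<^sub>v n) \<le> 1" by (auto simp: linf_norm_def)
  then show "{cmod ((A *\<^sub>v v) \<bullet>c w) | v w.
      v \<in> carrier_vec n \<and> w \<in> carrier_vec n \<and> linf_norm v \<le> 1 \<and> linf_norm w \<le> 1} \<noteq> {}"
    using zero_carrier_vec[of n] by blast
qed

text \<open>The crude bound \<open>8\<close> below comes from polarization on the vectors \<open>(v \<plusminus> w)/4\<close>, which lie in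
  the open polydisc.\<close>

lemma inf_one_norm_sym_coeff_mat_le:
  assumes p: "p \<in> quadratic_polys n" and N: "polydisc_norm n p \<le> 1"
  shows "inf_one_norm n (sym_coeff_mat n p) \<le> 8"
proof -
  let ?A = "sym_coeff_mat n p"
  have A: "?A \<in> symmetric_mats n" by (rule sym_coeff_mat(1)[OF p])
  then have cr: "?A \<in> carrier_mat n n" by (simp add: symmetric_mats_def)
  have sym: "?A $$ (j, k) = ?A $$ (k, j)" if "j < n" "k < n" for j k
    using A that index_transpose_mat(1)[of j ?A k] cr by (auto simp: symmetric_mats_def)
  have le1: "cmod (poly_eval p z) \<le> 1" if "z \<in> polydisc n" for z
    using cSUP_upper[OF that polydisc_norm_bdd(1)[OF p]] N by (simp add: polydisc_norm_def)
  have "cmod ((?A *\<^sub>v v) \<bullet>c w) \<le> 8"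
    if vw: "v \<in> carrier_vec n" "w \<in> carrier_vec n" "linf_norm v \<le> 1" "linf_norm w \<le> 1" for v w
  proof -
    have v: "cmod (v $ i) \<le> 1" "cmod (w $ i) \<le> 1" if "i < n" for i
      using vw linf_norm_le_iff[OF vw(1), of 1] linf_norm_le_iff[OF vw(2), of 1] that by auto
    define x where "x = vec n (\<lambda>i. (v $ i + cnj (w $ i)) / 4)"
    define y where "y = vec n (\<lambda>i. (v $ i - cnj (w $ i)) / 4)"
    have "cmod ((v $ i + cnj (w $ i)) / 4) < 1" "cmod ((v $ i - cnj (w $ i)) / 4) < 1"
      if "i < n" for i
      using v[OF that] norm_triangle_ineq[of "v $ i" "cnj (w $ i)"]
        norm_triangle_ineq4[of "v $ i" "cnj (w $ i)"] by (auto simp: norm_divide)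
    then have xy: "x \<in> polydisc n" "y \<in> polydisc n"
      by (auto simp: x_def y_def polydisc_def)
    have c: "x \<in> carrier_vec n" "y \<in> carrier_vec n" by (auto simp: x_def y_def)
    have swap: "(\<Sum>j<n. \<Sum>k<n. ?A $$ (j, k) * v $ j * cnj (w $ k)) =
        (\<Sum>j<n. \<Sum>k<n. ?A $$ (j, k) * v $ k * cnj (w $ j))"
      by (subst sum.swap) (intro sum.cong refl, simp add: sym)
    have "8 * (poly_eval p x - poly_eval p y) =
        (\<Sum>j<n. \<Sum>k<n. ?A $$ (j, k) * v $ j * cnj (w $ k)) +
        (\<Sum>j<n. \<Sum>k<n. ?A $$ (j, k) * v $ k * cnj (w $ j))"
      unfolding sym_coeff_mat(2)[OF p c(1)] sym_coeff_mat(2)[OF p c(2)]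
        sum_subtractf[symmetric] sum_distrib_left sum.distrib[symmetric]
      by (intro sum.cong refl) (simp add: x_def y_def field_simps)
    then have "2 * ((?A *\<^sub>v v) \<bullet>c w) = 2 * (4 * (poly_eval p x - poly_eval p y))"
      unfolding inner_mult_mat_vec[OF cr vw(1,2)] swap by (simp only: mult_2) simp
    then have "(?A *\<^sub>v v) \<bullet>c w = 4 * (poly_eval p x - poly_eval p y)"
      by (simp only: mult_cancel_left) simp
    also have "cmod \<dots> \<le> 4 * (cmod (poly_eval p x) + cmod (poly_eval p y))"
      unfolding norm_mult
      using norm_triangle_ineq4[of "poly_eval p x" "poly_eval p y"] by simp
    finally show ?thesis using le1[OF xy(1)] le1[OF xy(2)] by simp
  qed
  then show ?thesis
    unfolding inf_one_norm_def by (intro cSup_least inf_one_norm_bdd(2)[OF cr]) auto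
qed

lemma sym_coeff_norm_bdd:
  shows "bdd_above ((\<lambda>p. inf_one_norm n (sym_coeff_mat n p)) `
      {p \<in> quadratic_polys n. polydisc_norm n p \<le> 1})"
    and "{p \<in> quadratic_polys n. polydisc_norm n p \<le> 1} \<noteq> {}"
proof -
  show "bdd_above ((\<lambda>p. inf_one_norm n (sym_coeff_mat n p)) `
      {p \<in> quadratic_polys n. polydisc_norm n p \<le> 1})"
    by (rule bdd_aboveI2[of _ _ 8]) (use inf_one_norm_sym_coeff_mat_le in auto)
  have z: "0 \<in> quadratic_polys n" by (simp add: quadratic_polys_def)
  have "polydisc_norm n 0 = 0"
    using polydisc_norm_bdd(2)[OF z] by (simp add: polydisc_norm_def poly_eval_def)
  then show "{p \<in> quadratic_polys n. polydisc_norm n p \<le> 1} \<noteq> {}" using z by force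
qed

end

theory Submission
  imports Defs "HOL-Real_Asymp.Real_Asymp"
begin

text \<open>
  The norms increase with the dimension, because a quadratic polynomial in \<open>m\<close> variables is also one
  in \<open>n \<ge> m\<close> variables, and they are bounded by \<open>8\<close>; so the limit exists. It remains to exhibit
  matrices for which the ratio of the two norms tends to \<open>\<pi>\<^sup>2 / 8\<close>.

  Let \<open>\<theta>\<^sub>j = 2\<pi>j/n\<close> and take the symmetric matrix with entries \<open>cos (\<theta>\<^sub>j - \<theta>\<^sub>k)\<close>. Its
  quadratic form is \<open>C\<^sup>2 + S\<^sup>2\<close>, where \<open>C = \<Sum> z\<^sub>j cos \<theta>\<^sub>j\<close> and \<open>S = \<Sum> z\<^sub>j sin \<theta>\<^sub>j\<close>. Multiplying
  \<open>z\<close> by a scalar of modulus one makes the value of the form real and nonnegative; that value is then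
  at most \<open>(Re C)\<^sup>2 + (Re S)\<^sup>2\<close>, so only the real parts of the \<open>z\<^sub>j\<close> count. A real combination
  \<open>\<Sum> x\<^sub>j e\<^bsup>i\<theta>\<^sub>j\<^esup>\<close> with \<open>\<bar>x\<^sub>j\<bar> \<le> 1\<close> has modulus at most \<open>max\<^sub>\<phi> \<Sum> \<bar>cos (\<theta>\<^sub>j - \<phi>)\<bar>\<close>, about
  \<open>2n/\<pi>\<close>, which bounds the quadratic form by about \<open>4n\<^sup>2/\<pi>\<^sup>2\<close> (\<open>cosine_form_le\<close>).
  The bilinear form, on the other hand, has two independent arguments, and the complex vectors
  \<open>v\<^sub>k = e\<^bsup>-i\<theta>\<^sub>k\<^esup>\<close> and \<open>w = v\<close> give it the value \<open>n\<^sup>2/2\<close> (\<open>cosine_bilinear_value\<close>). The quotient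
  of \<open>n\<^sup>2/2\<close> and \<open>4n\<^sup>2/\<pi>\<^sup>2\<close> is \<open>\<pi>\<^sup>2/8\<close>. With \<open>1 / sin (\<pi>/n)\<close> in place of \<open>n/\<pi>\<close> the estimates are
  exact inequalities, and \<open>sym_coeff_norm_ge\<close> is the resulting bound for each \<open>n \<ge> 3\<close>.
\<close>

section \<open>The sequence of norms converges\<close>

lemma poly_eval_cong:
  assumes "p \<in> quadratic_polys n" "\<And>i. i < n \<Longrightarrow> z $ i = z' $ i"
  shows "poly_eval p z = poly_eval p z'"
  unfolding poly_eval_def
proof (intro sum.cong refl arg_cong2[where f = "(*)"] prod.cong)
  fix m i
  assume "m \<in> Poly_Mapping.keys p" "i \<in> Poly_Mapping.keys m"
  then have "i < n" using assms(1) by (auto simp: quadratic_polys_def)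
  then show "z $ i ^ Poly_Mapping.lookup m i = z' $ i ^ Poly_Mapping.lookup m i"
    using assms(2) by simp
qed

lemma quadratic_polys_mono:
  assumes "m \<le> n"
  shows "quadratic_polys m \<subseteq> quadratic_polys n"
  using assms by (force simp: quadratic_polys_def)

text \<open>Discarding the variables that \<open>p\<close> does not contain maps the larger polydisc into the smaller
  one.\<close>

lemma polydisc_norm_antimono:
  assumes p: "p \<in> quadratic_polys m" and mn: "m \<le> n"
  shows "polydisc_norm n p \<le> polydisc_norm m p"
proof -
  have pn: "p \<in> quadratic_polys n" using quadratic_polys_mono[OF mn] p by blast
  show ?thesis
    unfolding polydisc_norm_def[of n]
  proof (rule cSUP_least)
    show "polydisc n \<noteq> {}" by (rule polydisc_norm_bdd(2)[OF pn])
  next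
    fix z assume z: "z \<in> polydisc n"
    let ?z = "vec m (\<lambda>i. z $ i)"
    have "?z \<in> polydisc m" using z mn by (auto simp: polydisc_def)
    then have "cmod (poly_eval p ?z) \<le> polydisc_norm m p"
      unfolding polydisc_norm_def by (rule cSUP_upper[OF _ polydisc_norm_bdd(1)[OF p]])
    moreover have "poly_eval p z = poly_eval p ?z" by (rule poly_eval_cong[OF p]) simp
    ultimately show "cmod (poly_eval p z) \<le> polydisc_norm m p" by simp
  qed
qed

lemma double_sum_zero_extension:
  fixes f :: "nat \<Rightarrow> nat \<Rightarrow> complex"
  assumes "m \<le> n" "\<And>j k. m \<le> j \<or> m \<le> k \<Longrightarrow> j < n \<Longrightarrow> k < n \<Longrightarrow> f j k = 0"
  shows "(\<Sum>j<n. \<Sum>k<n. f j k) = (\<Sum>j<m. \<Sum>k<m. f j k)"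
proof -
  have "(\<Sum>j<n. \<Sum>k<n. f j k) = (\<Sum>j<m. \<Sum>k<n. f j k)"
    using assms by (intro sum.mono_neutral_right ballI sum.neutral) auto
  also have "\<dots> = (\<Sum>j<m. \<Sum>k<m. f j k)"
    using assms by (intro sum.cong refl sum.mono_neutral_right) auto
  finally show ?thesis .
qed

lemma symmetric_mats_entry:
  assumes "A \<in> symmetric_mats n" "j < n" "k < n"
  shows "A $$ (j, k) = A $$ (k, j)"
  using assms index_transpose_mat(1)[of j A k] by (auto simp: symmetric_mats_def)

text \<open>Extending \<open>z\<close> by zeros shows that the leading block of the larger matrix represents \<open>p\<close> in the
  first \<open>m\<close> variables; the matrix with this property is unique.\<close>

lemma sym_coeff_mat_block:
  assumes p: "p \<in> quadratic_polys m" and mn: "m \<le> n" and jk: "j < m" "k < m"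
  shows "sym_coeff_mat m p $$ (j, k) = sym_coeff_mat n p $$ (j, k)"
proof -
  have pn: "p \<in> quadratic_polys n" using quadratic_polys_mono[OF mn] p by blast
  define B where "B = mat m m (\<lambda>jk. sym_coeff_mat n p $$ jk)"
  have "B \<in> symmetric_mats m"
    using mn symmetric_mats_entry[OF sym_coeff_mat(1)[OF pn]]
    by (auto simp: B_def symmetric_mats_def intro!: eq_matI)
  moreover have "poly_eval p z = (\<Sum>j<m. \<Sum>k<m. B $$ (j, k) * z $ j * z $ k)"
    if "z \<in> carrier_vec m" for z
  proof -
    let ?z = "vec n (\<lambda>i. if i < m then z $ i else 0)"
    have "poly_eval p z = poly_eval p ?z" using mn by (intro poly_eval_cong[OF p]) simp
    also have "\<dots> = (\<Sum>j<n. \<Sum>k<n. sym_coeff_mat n p $$ (j, k) * ?z $ j * ?z $ k)"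
      by (rule sym_coeff_mat(2)[OF pn]) simp
    also have "\<dots> = (\<Sum>j<m. \<Sum>k<m. sym_coeff_mat n p $$ (j, k) * ?z $ j * ?z $ k)"
      by (rule double_sum_zero_extension[OF mn]) auto
    also have "\<dots> = (\<Sum>j<m. \<Sum>k<m. B $$ (j, k) * z $ j * z $ k)"
      using mn by (intro sum.cong refl) (simp add: B_def)
    finally show ?thesis .
  qed
  ultimately have "sym_coeff_mat m p = B"
    using sym_coeff_mat[OF p] by (intro symmetric_form_unique[of _ m]) auto
  then show ?thesis using jk by (simp add: B_def)
qed

text \<open>Test vectors in dimension \<open>m\<close>, extended by zeros, are test vectors in dimension \<open>n\<close> with the
  same value of the bilinear form.\<close>

lemma inf_one_norm_mono:
  assumes p: "p \<in> quadratic_polys m" and mn: "m \<le> n"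
  shows "inf_one_norm m (sym_coeff_mat m p) \<le> inf_one_norm n (sym_coeff_mat n p)"
proof -
  have pn: "p \<in> quadratic_polys n" using quadratic_polys_mono[OF mn] p by blast
  have cr: "sym_coeff_mat m p \<in> carrier_mat m m" "sym_coeff_mat n p \<in> carrier_mat n n"
    using sym_coeff_mat(1)[OF p] sym_coeff_mat(1)[OF pn] by (auto simp: symmetric_mats_def)
  have "cmod ((sym_coeff_mat m p *\<^sub>v v) \<bullet>c w) \<le> inf_one_norm n (sym_coeff_mat n p)"
    if vw: "v \<in> carrier_vec m" "w \<in> carrier_vec m" "linf_norm v \<le> 1" "linf_norm w \<le> 1" for v w
  proof -
    define e where "e = (\<lambda>u :: complex vec. vec n (\<lambda>i. if i < m then u $ i else 0))"
    have e: "e u \<in> carrier_vec n" for u by (simp add: e_def)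
    have e1: "linf_norm (e u) \<le> 1" if "u \<in> carrier_vec m" "linf_norm u \<le> 1" for u
      using that linf_norm_le_iff[OF e, of 1] linf_norm_le_iff[OF that(1), of 1]
      by (auto simp: e_def)
    have "(sym_coeff_mat m p *\<^sub>v v) \<bullet>c w =
        (\<Sum>j<m. \<Sum>k<m. sym_coeff_mat n p $$ (j, k) * e v $ k * cnj (e w $ j))"
      unfolding inner_mult_mat_vec[OF cr(1) vw(1,2)] using mn
      by (intro sum.cong refl) (simp add: e_def sym_coeff_mat_block[OF p mn])
    also have "\<dots> = (\<Sum>j<n. \<Sum>k<n. sym_coeff_mat n p $$ (j, k) * e v $ k * cnj (e w $ j))"
      by (rule double_sum_zero_extension[OF mn, symmetric]) (auto simp: e_def)
    also have "\<dots> = (sym_coeff_mat n p *\<^sub>v e v) \<bullet>c e w"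
      by (rule inner_mult_mat_vec[OF cr(2) e e, symmetric])
    finally show ?thesis
      unfolding inf_one_norm_def using e e1 vw
      by (intro cSup_upper inf_one_norm_bdd(1)[OF cr(2)]) auto
  qed
  then show ?thesis
    unfolding inf_one_norm_def[of m] by (intro cSup_least inf_one_norm_bdd(2)[OF cr(1)]) auto
qed

lemma sym_coeff_norm_mono: "mono sym_coeff_norm"
proof (rule monoI)
  fix m n :: nat assume mn: "m \<le> n"
  show "sym_coeff_norm m \<le> sym_coeff_norm n"
    unfolding sym_coeff_norm_def op_norm_def
  proof (rule cSUP_mono[OF sym_coeff_norm_bdd(2) sym_coeff_norm_bdd(1)])
    fix p assume "p \<in> {p \<in> quadratic_polys m. polydisc_norm m p \<le> 1}"
    then show "\<exists>q\<in>{p \<in> quadratic_polys n. polydisc_norm n p \<le> 1}.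
        inf_one_norm m (sym_coeff_mat m p) \<le> inf_one_norm n (sym_coeff_mat n q)"
      using quadratic_polys_mono[OF mn] polydisc_norm_antimono[OF _ mn] inf_one_norm_mono[OF _ mn]
      by (intro bexI[of _ p]) force+
  qed
qed

lemma sym_coeff_norm_le: "sym_coeff_norm n \<le> 8"
  unfolding sym_coeff_norm_def op_norm_def
  by (rule cSUP_least[OF sym_coeff_norm_bdd(2)]) (use inf_one_norm_sym_coeff_mat_le in auto)

lemma convergent_sym_coeff_norm: "convergent sym_coeff_norm"
proof -
  obtain L where "sym_coeff_norm \<longlonglongrightarrow> L"
    by (rule incseq_convergent[OF sym_coeff_norm_mono, of 8]) (use sym_coeff_norm_le in auto)
  then show ?thesis by (rule convergentI)
qed

section \<open>Every symmetric matrix comes from a polynomial\<close>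

text \<open>Summing over a set that contains the support makes evaluations of different polynomials
  comparable, as additivity requires.\<close>

lemma poly_eval_superset:
  assumes "finite S" "Poly_Mapping.keys p \<subseteq> S"
  shows "poly_eval p z = (\<Sum>m\<in>S. Poly_Mapping.lookup p m *
    (\<Prod>i\<in>Poly_Mapping.keys m. (z $ i) ^ Poly_Mapping.lookup m i))"
  unfolding poly_eval_def using assms
  by (intro sum.mono_neutral_left) (auto simp: in_keys_iff)

lemma poly_eval_add: "poly_eval (p + q) z = poly_eval p z + poly_eval q z"
proof -
  let ?S = "Poly_Mapping.keys p \<union> Poly_Mapping.keys q"
  have "Poly_Mapping.keys (p + q) \<subseteq> ?S" by (rule Poly_Mapping.keys_add)
  then show ?thesis
    by (simp add: poly_eval_superset[of ?S] lookup_add distrib_right sum.distrib)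
qed

lemma quadratic_polys_add:
  assumes "p \<in> quadratic_polys n" "q \<in> quadratic_polys n"
  shows "p + q \<in> quadratic_polys n"
  using assms Poly_Mapping.keys_add[of p q] by (fastforce simp: quadratic_polys_def)

lemma quadratic_monomial:
  assumes "j < n" "k < n"
  shows "\<exists>p\<in>quadratic_polys n. \<forall>z. poly_eval p z = c * (z $ j * z $ k)"
proof -
  define m where "m = Poly_Mapping.single j (1::nat) + Poly_Mapping.single k 1"
  have keys: "Poly_Mapping.keys m = {j, k}"
    by (auto simp: m_def in_keys_iff lookup_add lookup_single when_def split: if_splits)
  have lookup: "Poly_Mapping.lookup m i = (if i = j then 1 else 0) + (if i = k then 1 else 0)" for i
    by (auto simp: m_def lookup_add lookup_single when_def)
  have deg: "(\<Sum>i\<in>Poly_Mapping.keys m. Poly_Mapping.lookup m i) = 2"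
    by (cases "j = k") (auto simp: keys lookup)
  have ev: "(\<Prod>i\<in>Poly_Mapping.keys m. (z $ i) ^ Poly_Mapping.lookup m i) = z $ j * z $ k"
    for z :: "complex vec"
    by (cases "j = k") (auto simp: keys lookup)
  have "Poly_Mapping.single m c \<in> quadratic_polys n"
    using keys deg assms by (auto simp: quadratic_polys_def)
  moreover have "poly_eval (Poly_Mapping.single m c) z = c * (z $ j * z $ k)" for z
    by (subst poly_eval_superset[of "{m}"]) (auto simp: ev)
  ultimately show ?thesis by blast
qed

lemma quadratic_poly_sum:
  assumes "finite I" "\<And>i. i \<in> I \<Longrightarrow> \<exists>p\<in>quadratic_polys n. \<forall>z. poly_eval p z = f i z"
  shows "\<exists>p\<in>quadratic_polys n. \<forall>z. poly_eval p z = (\<Sum>i\<in>I. f i z)"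
  using assms
proof (induction I rule: finite_induct)
  case empty
  have "0 \<in> quadratic_polys n" by (simp add: quadratic_polys_def)
  then show ?case by (intro bexI[of _ 0]) (auto simp: poly_eval_def)
next
  case (insert i I)
  obtain p where p: "p \<in> quadratic_polys n" "\<And>z. poly_eval p z = (\<Sum>i\<in>I. f i z)"
    using insert by auto
  obtain q where q: "q \<in> quadratic_polys n" "\<And>z. poly_eval q z = f i z"
    using insert.prems by blast
  show ?case
    using insert.hyps p q
    by (intro bexI[of _ "q + p"] quadratic_polys_add) (auto simp: poly_eval_add)
qed

lemma sym_coeff_mat_surj:
  assumes A: "A \<in> symmetric_mats n"
  obtains p where "p \<in> quadratic_polys n" "sym_coeff_mat n p = A"
    "\<And>z. poly_eval p z = (\<Sum>j<n. \<Sum>k<n. A $$ (j, k) * z $ j * z $ k)"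
proof -
  have "\<exists>p\<in>quadratic_polys n. \<forall>z. poly_eval p z = (\<Sum>j<n. \<Sum>k<n. A $$ (j, k) * z $ j * z $ k)"
    by (intro quadratic_poly_sum) (auto simp: mult.assoc intro!: quadratic_monomial)
  then obtain p where p: "p \<in> quadratic_polys n"
    "\<And>z. poly_eval p z = (\<Sum>j<n. \<Sum>k<n. A $$ (j, k) * z $ j * z $ k)" by blast
  have "sym_coeff_mat n p = A"
    using sym_coeff_mat[OF p(1)] p(2) A by (intro symmetric_form_unique[of _ n]) auto
  with p that show ?thesis by blast
qed

text \<open>This turns lower bounds for the operator norm into statements about sums over matrix entries:
  polynomials no longer occur.\<close>

lemma bilinear_form_le_sym_coeff_norm:
  assumes A: "A \<in> symmetric_mats n"
    and form: "\<And>z. z \<in> polydisc n \<Longrightarrow> cmod (\<Sum>j<n. \<Sum>k<n. A $$ (j, k) * z $ j * z $ k) \<le> 1"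
    and v: "\<And>i. i < n \<Longrightarrow> cmod (v i) \<le> 1" and w: "\<And>i. i < n \<Longrightarrow> cmod (w i) \<le> 1"
  shows "cmod (\<Sum>j<n. \<Sum>k<n. A $$ (j, k) * v k * cnj (w j)) \<le> sym_coeff_norm n"
proof -
  obtain p where p: "p \<in> quadratic_polys n" "sym_coeff_mat n p = A"
    "\<And>z. poly_eval p z = (\<Sum>j<n. \<Sum>k<n. A $$ (j, k) * z $ j * z $ k)"
    using sym_coeff_mat_surj[OF A] by blast
  have "polydisc_norm n p \<le> 1"
    unfolding polydisc_norm_def using form p(3)
    by (intro cSUP_least polydisc_norm_bdd(2)[OF p(1)]) auto
  then have "inf_one_norm n (sym_coeff_mat n p) \<le> sym_coeff_norm n"
    unfolding sym_coeff_norm_def op_norm_def using p(1)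
    by (intro cSUP_upper sym_coeff_norm_bdd(1)) auto
  then have A_le: "inf_one_norm n A \<le> sym_coeff_norm n" by (simp add: p(2))
  have cr: "A \<in> carrier_mat n n" using A by (simp add: symmetric_mats_def)
  have unit: "linf_norm (vec n v) \<le> 1" "linf_norm (vec n w) \<le> 1"
    using linf_norm_le_iff[of "vec n v" n 1] linf_norm_le_iff[of "vec n w" n 1] v w by auto
  have "cmod ((A *\<^sub>v vec n v) \<bullet>c vec n w) \<le> inf_one_norm n A"
    unfolding inf_one_norm_def using unit vec_carrier[of n v] vec_carrier[of n w]
    by (intro cSup_upper inf_one_norm_bdd(1)[OF cr]) blast
  moreover have "(A *\<^sub>v vec n v) \<bullet>c vec n w = (\<Sum>j<n. \<Sum>k<n. A $$ (j, k) * v k * cnj (w j))"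
    by (subst inner_mult_mat_vec[OF cr]) simp_all
  ultimately show ?thesis using A_le by simp
qed

section \<open>Real combinations of equally spaced points on the circle\<close>

text \<open>The primitive of \<open>\<bar>cos\<bar>\<close> that vanishes at \<open>0\<close>. The integer \<open>k\<close> is the one for which \<open>t - k\<pi>\<close>
  lies in \<open>[-\<pi>/2, \<pi>/2)\<close>, where \<open>sin\<close> increases, and each period of length \<open>\<pi>\<close> contributes
  \<open>2\<close> to the integral.\<close>

definition abs_cos_primitive :: "real \<Rightarrow> real" where
  "abs_cos_primitive t = (let k = \<lfloor>t / pi + 1 / 2\<rfloor> in 2 * k + sin (t - k * pi))"

lemma abs_cos_primitive_shift: "abs_cos_primitive (t + of_int k * pi) = abs_cos_primitive t + 2 * k"
proof -
  have "(t + of_int k * pi) / pi + 1 / 2 = (t / pi + 1 / 2) + of_int k" by (simp add: field_simps)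
  then have "\<lfloor>(t + of_int k * pi) / pi + 1 / 2\<rfloor> = \<lfloor>t / pi + 1 / 2\<rfloor> + k" by (metis floor_add_int)
  then show ?thesis by (simp add: abs_cos_primitive_def Let_def algebra_simps)
qed

text \<open>The next two lemmas compare \<open>\<bar>cos\<bar>\<close> with \<open>cos\<close> after integration. The primitives of both agree
  on \<open>[-\<pi>/2, \<pi>/2)\<close>; outside this interval the term \<open>2 k\<close> outweighs the difference of two sines.\<close>

lemma sin_le_abs_cos_primitive:
  assumes "- pi / 2 \<le> t"
  shows "sin t \<le> abs_cos_primitive t"
proof -
  define k where "k = \<lfloor>t / pi + 1 / 2\<rfloor>"
  have "0 \<le> t / pi + 1 / 2" using assms by (simp add: field_simps)
  then have "k = 0 \<or> k \<ge> 1" unfolding k_def by linarith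
  moreover have "abs_cos_primitive t = 2 * k + sin (t - k * pi)"
    by (simp add: abs_cos_primitive_def k_def Let_def)
  ultimately show ?thesis using sin_le_one[of t] sin_ge_minus_one[of "t - k * pi"]
    by (elim disjE) (simp, linarith)
qed

lemma abs_cos_primitive_le_sin:
  assumes "t < pi / 2"
  shows "abs_cos_primitive t \<le> sin t"
proof -
  define k where "k = \<lfloor>t / pi + 1 / 2\<rfloor>"
  have "t / pi + 1 / 2 < 1" using assms by (simp add: field_simps)
  then have "k = 0 \<or> k \<le> -1" unfolding k_def by linarith
  moreover have "abs_cos_primitive t = 2 * k + sin (t - k * pi)"
    by (simp add: abs_cos_primitive_def k_def Let_def)
  ultimately show ?thesis using sin_ge_minus_one[of t] sin_le_one[of "t - k * pi"]
    by (elim disjE) (simp, linarith)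
qed

text \<open>In terms of integrals: \<open>2 sin h \<bar>cos t\<bar>\<close> is the modulus of the integral of \<open>cos\<close> over
  \<open>[t - h, t + h]\<close> when \<open>sin h \<ge> 0\<close>, and the right-hand side is the integral of \<open>\<bar>cos\<bar>\<close>. A shift of \<open>t\<close>
  by a multiple of \<open>\<pi>\<close> reduces the claim to \<open>t \<in> [-\<pi>/2, \<pi>/2)\<close>.\<close>

lemma abs_cos_le_primitive_diff:
  assumes "0 \<le> h"
  shows "2 * sin h * \<bar>cos t\<bar> \<le> abs_cos_primitive (t + h) - abs_cos_primitive (t - h)"
proof -
  define k where "k = \<lfloor>t / pi + 1 / 2\<rfloor>"
  define s where "s = t - k * pi"
  have t: "t = s + of_int k * pi" by (simp add: s_def)
  have "of_int k \<le> t / pi + 1 / 2" "t / pi + 1 / 2 < of_int k + 1" unfolding k_def by linarith+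
  then have s: "- pi / 2 \<le> s" "s < pi / 2"
    by (simp_all add: s_def field_simps)
  have "\<bar>cos t\<bar> = \<bar>cos s\<bar>"
  proof -
    have "sin (of_int k * pi) = 0" using sin_zero_iff_int2 by blast
    moreover from this have "\<bar>cos (of_int k * pi)\<bar> = 1"
      using sin_cos_squared_add[of "of_int k * pi"] by (auto simp: power2_eq_1_iff)
    ultimately show ?thesis by (simp add: t cos_add abs_mult)
  qed
  also have "\<dots> = cos s" using s by (simp add: cos_ge_zero)
  finally have "2 * sin h * \<bar>cos t\<bar> = sin (s + h) - sin (s - h)"
    by (simp add: sin_add sin_diff)
  also have "\<dots> \<le> abs_cos_primitive (s + h) - abs_cos_primitive (s - h)"
    using sin_le_abs_cos_primitive[of "s + h"] abs_cos_primitive_le_sin[of "s - h"] s assms by simp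
  also have "\<dots> = abs_cos_primitive (t + h) - abs_cos_primitive (t - h)"
    using abs_cos_primitive_shift[of "s + h" k] abs_cos_primitive_shift[of "s - h" k]
    by (simp add: t algebra_simps)
  finally show ?thesis .
qed

text \<open>For \<open>h = \<pi>/n\<close> the intervals of radius \<open>h\<close> around the \<open>n\<close> sample points tile one full turn, over
  which \<open>\<bar>cos\<bar>\<close> has integral \<open>4\<close>. The bound is therefore uniform in the phase \<open>\<phi>\<close>.\<close>

lemma sum_abs_cos_le:
  fixes n :: nat
  assumes "2 \<le> n"
  shows "(\<Sum>j<n. \<bar>cos (2 * pi * j / n - \<phi>)\<bar>) \<le> 2 / sin (pi / n)"
proof -
  define h where "h = pi / n"
  have h: "0 < h" "h < pi" using assms by (simp_all add: h_def field_simps)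
  define f where "f j = abs_cos_primitive (2 * h * real j - h - \<phi>)" for j
  have "2 * sin h * (\<Sum>j<n. \<bar>cos (2 * pi * j / n - \<phi>)\<bar>) \<le> (\<Sum>j<n. f (Suc j) - f j)"
    unfolding sum_distrib_left
  proof (rule sum_mono)
    fix j
    show "2 * sin h * \<bar>cos (2 * pi * real j / real n - \<phi>)\<bar> \<le> f (Suc j) - f j"
    proof -
      have eqs: "2 * h * real j - \<phi> + h = 2 * h * real (Suc j) - h - \<phi>"
        "2 * h * real j - \<phi> - h = 2 * h * real j - h - \<phi>"
        "2 * h * real j - \<phi> = 2 * pi * real j / real n - \<phi>"
        by (simp_all add: h_def algebra_simps add_divide_distrib)
      show ?thesis
        unfolding f_def eqs[symmetric] using h(1) by (intro abs_cos_le_primitive_diff) simp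
    qed
  qed
  also have "\<dots> = f n - f 0" by (rule sum_lessThan_telescope)
  also have "\<dots> = 4"
  proof -
    have "2 * h * real n - h - \<phi> = (- h - \<phi>) + of_int 2 * pi" using assms by (simp add: h_def)
    then show ?thesis unfolding f_def by (simp only: abs_cos_primitive_shift) simp
  qed
  finally show ?thesis
    using sin_gt_zero[OF h] by (simp add: h_def field_simps)
qed

text \<open>The modulus of a complex number is its component in its own direction \<open>\<phi>\<close>, and that component of
  \<open>e\<^bsup>i\<theta>\<^esup>\<close> is \<open>cos (\<theta> - \<phi>)\<close>.\<close>

lemma real_combination_circle_le:
  fixes n :: nat
  assumes "2 \<le> n" "\<And>j. j < n \<Longrightarrow> \<bar>x j\<bar> \<le> (1::real)"
  shows "cmod (\<Sum>j<n. x j * cis (2 * pi * j / n)) \<le> 2 / sin (pi / n)"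
proof -
  define S where "S = (\<Sum>j<n. x j * cis (2 * pi * j / n))"
  define \<phi> where "\<phi> = Arg S"
  have "S = cmod S * cis \<phi>" using rcis_cmod_Arg[of S] by (simp add: rcis_def \<phi>_def)
  then have "S * cis (- \<phi>) = cmod S" by (metis cis_divide cis_inverse divide_complex_def
    divide_self_if cis_neq_zero mult.assoc mult.right_neutral)
  then have "cmod S = Re (S * cis (- \<phi>))" by simp
  also have "\<dots> = (\<Sum>j<n. x j * cos (2 * pi * j / n - \<phi>))"
    by (simp add: S_def sum_distrib_right mult.assoc cis_mult)
  also have "\<dots> \<le> (\<Sum>j<n. \<bar>cos (2 * pi * j / n - \<phi>)\<bar>)"
  proof (rule sum_mono)
    fix j assume "j \<in> {..<n}"
    then have "\<bar>x j * cos (2 * pi * j / n - \<phi>)\<bar> \<le> \<bar>cos (2 * pi * j / n - \<phi>)\<bar>"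
      using assms(2)[of j] by (simp add: abs_mult mult_left_le_one_le)
    then show "x j * cos (2 * pi * j / n - \<phi>) \<le> \<bar>cos (2 * pi * j / n - \<phi>)\<bar>" by linarith
  qed
  also have "\<dots> \<le> 2 / sin (pi / n)" by (rule sum_abs_cos_le[OF assms(1)])
  finally show ?thesis unfolding S_def .
qed

section \<open>The cosine matrix\<close>

text \<open>The form is \<open>C\<^sup>2 + S\<^sup>2\<close> for two linear forms with real coefficients. Since it is homogeneous of
  degree two, multiplying \<open>z\<close> by a square root \<open>u\<close> of the inverse phase of its value \<open>Q\<close> makes that
  value equal to \<open>\<bar>Q\<bar>\<close>. Then \<open>\<bar>Q\<bar> = (Re C)\<^sup>2 + (Re S)\<^sup>2 - (Im C)\<^sup>2 - (Im S)\<^sup>2\<close>, and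
  dropping the imaginary parts leaves a combination with real weights.\<close>

lemma cosine_form_le:
  fixes n :: nat and z :: "nat \<Rightarrow> complex"
  assumes n: "2 \<le> n" and z: "\<And>j. j < n \<Longrightarrow> cmod (z j) \<le> 1"
  shows "cmod (\<Sum>j<n. \<Sum>k<n. cos (2 * pi * j / n - 2 * pi * k / n) * z j * z k)
    \<le> 4 / (sin (pi / n))\<^sup>2"
proof -
  define \<theta> where "\<theta> j = 2 * pi * real j / n" for j
  define Q where "Q = (\<Sum>j<n. \<Sum>k<n. cos (\<theta> j - \<theta> k) * z j * z k)"
  define u where "u = cis (- Arg Q / 2)"
  define C where "C = (\<Sum>j<n. u * z j * cos (\<theta> j))"
  define S where "S = (\<Sum>j<n. u * z j * sin (\<theta> j))"
  define x where "x j = Re (u * z j)" for j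
  have "C\<^sup>2 + S\<^sup>2 = (\<Sum>j<n. \<Sum>k<n. (u * u) * (cos (\<theta> j - \<theta> k) * z j * z k))"
    unfolding C_def S_def power2_eq_square sum_product sum.distrib[symmetric]
    by (intro sum.cong refl) (simp add: cos_diff algebra_simps)
  also have "\<dots> = cis (- Arg Q) * Q"
    by (simp add: Q_def sum_distrib_left u_def cis_mult)
  also have "\<dots> = cmod Q"
  proof -
    have "Q = cmod Q * cis (Arg Q)" using rcis_cmod_Arg[of Q] by (simp add: rcis_def)
    then have "cis (- Arg Q) * Q = cmod Q * (cis (Arg Q) * cis (- Arg Q))"
      by (metis mult.assoc mult.commute)
    then show ?thesis by (simp add: cis_mult)
  qed
  finally have "cmod Q = Re (C\<^sup>2 + S\<^sup>2)" by simp
  also have "\<dots> \<le> (Re C)\<^sup>2 + (Re S)\<^sup>2"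
    by (simp add: power2_eq_square)
  also have "\<dots> = (cmod (\<Sum>j<n. x j * cis (\<theta> j)))\<^sup>2"
    by (simp add: cmod_power2 C_def S_def x_def)
  also have "\<dots> \<le> (2 / sin (pi / n))\<^sup>2"
  proof (intro power_mono norm_ge_zero)
    have "\<bar>x j\<bar> \<le> 1" if "j < n" for j
    proof -
      have "\<bar>x j\<bar> \<le> cmod (u * z j)" unfolding x_def by (rule abs_Re_le_cmod)
      also have "\<dots> \<le> 1" using z[OF that] by (simp add: norm_mult u_def)
      finally show ?thesis .
    qed
    then show "cmod (\<Sum>j<n. x j * cis (\<theta> j)) \<le> 2 / sin (pi / n)"
      unfolding \<theta>_def by (rule real_combination_circle_le[OF n])
  qed
  finally show ?thesis by (simp add: Q_def \<theta>_def power_divide)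
qed

text \<open>The squares form a geometric progression with quotient \<open>e\<^bsup>4\<pi>i/n\<^esup>\<close>, which differs from \<open>1\<close>
  unless \<open>n\<close> divides \<open>2\<close>.\<close>

lemma sum_roots_of_unity_square:
  fixes n :: nat
  assumes "3 \<le> n"
  shows "(\<Sum>j<n. cis (2 * pi * j / n) ^ 2) = 0"
proof -
  define q where "q = cis (4 * pi / n)"
  have "q \<noteq> 1"
  proof
    assume "q = 1"
    then have "cos (4 * pi / n) = 1" by (simp add: q_def complex_eq_iff)
    then obtain k :: int where "4 * pi / n = of_int k * 2 * pi" unfolding cos_one_2pi_int by blast
    then have "4 * pi = of_int (2 * k * int n) * pi" using assms by (simp add: field_simps)
    then have "real_of_int (2 * k * int n) = 4" by simp
    then have "2 * k * int n = 4" by linarith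
    then have "k * int n = 2" by simp
    then have "int n dvd 2" by (metis dvd_triv_right)
    then show False using assms zdvd_imp_le[of "int n" 2] by simp
  qed
  have "(\<Sum>j<n. cis (2 * pi * j / n) ^ 2) = (\<Sum>j<n. q ^ j)"
    by (simp add: q_def Complex.DeMoivre mult_ac)
  also have "\<dots> = (q ^ n - 1) / (q - 1)" using \<open>q \<noteq> 1\<close> by (rule geometric_sum)
  also have "q ^ n = 1"
    using assms by (simp add: q_def Complex.DeMoivre complex_eq_iff cos_one_2pi_int sin_zero_iff_int2)
  finally show ?thesis by simp
qed

text \<open>Each cosine is half the sum of \<open>e\<^bsup>i(\<theta>\<^sub>j - \<theta>\<^sub>k)\<^esup>\<close> and its conjugate. Multiplication by
  \<open>e\<^bsup>i(\<theta>\<^sub>j - \<theta>\<^sub>k)\<^esup>\<close> turns the conjugate into the constant \<open>1\<close>, which contributes \<open>n\<^sup>2/2\<close>,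
  and the other summand into \<open>e\<^bsup>2i(\<theta>\<^sub>j - \<theta>\<^sub>k)\<^esup>\<close>, which sums to zero.\<close>

lemma cosine_bilinear_value:
  fixes n :: nat
  assumes n: "3 \<le> n"
  shows "(\<Sum>j<n. \<Sum>k<n. cos (2 * pi * j / n - 2 * pi * k / n) *
      cis (- (2 * pi * k / n)) * cis (2 * pi * j / n)) = complex_of_real ((real n)\<^sup>2 / 2)"
proof -
  define \<theta> where "\<theta> j = 2 * pi * real j / n" for j
  have "cos (\<theta> j - \<theta> k) * cis (- \<theta> k) * cis (\<theta> j) = 1 / 2 + (cis (\<theta> j) ^ 2 / 2) * cis (- \<theta> k) ^ 2"
    for j k
  proof -
    have "complex_of_real (cos t) = (cis t + cis (- t)) / 2" for t by (simp add: complex_eq_iff)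
    then have "cos (\<theta> j - \<theta> k) * cis (- \<theta> k) * cis (\<theta> j) =
        (cis (\<theta> j - \<theta> k) + cis (\<theta> k - \<theta> j)) / 2 * cis (\<theta> j - \<theta> k)"
      by (simp add: mult.assoc cis_mult)
    also have "\<dots> = 1 / 2 + cis (2 * \<theta> j - 2 * \<theta> k) / 2"
      by (simp add: distrib_right add_divide_distrib cis_mult)
    also have "cis (2 * \<theta> j - 2 * \<theta> k) = cis (\<theta> j) ^ 2 * cis (- \<theta> k) ^ 2"
      by (simp add: Complex.DeMoivre cis_mult)
    finally show ?thesis by simp
  qed
  then have "(\<Sum>j<n. \<Sum>k<n. cos (\<theta> j - \<theta> k) * cis (- \<theta> k) * cis (\<theta> j)) =
      (\<Sum>j<n. \<Sum>k<n. 1 / 2 + (cis (\<theta> j) ^ 2 / 2) * cis (- \<theta> k) ^ 2)" by simp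
  also have "\<dots> = of_nat n * of_nat n / 2 + (\<Sum>j<n. cis (\<theta> j) ^ 2) / 2 * (\<Sum>k<n. cis (- \<theta> k) ^ 2)"
    by (simp add: sum.distrib sum_distrib_left[symmetric] sum_distrib_right[symmetric]
        sum_divide_distrib[symmetric])
  also have "(\<Sum>j<n. cis (\<theta> j) ^ 2) = 0"
    unfolding \<theta>_def by (rule sum_roots_of_unity_square[OF n])
  finally show ?thesis by (simp add: \<theta>_def power2_eq_square)
qed

lemma sym_coeff_norm_ge:
  fixes n :: nat
  assumes n: "3 \<le> n"
  shows "(real n * sin (pi / n))\<^sup>2 / 8 \<le> sym_coeff_norm n"
proof -
  define \<theta> where "\<theta> j = 2 * pi * real j / n" for j
  \<comment> \<open>the normalization that brings the quadratic form below \<open>1\<close> on the polydisc\<close>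
  define c where "c = (sin (pi / n))\<^sup>2 / 4"
  define A where "A = mat n n (\<lambda>(j, k). complex_of_real (c * cos (\<theta> j - \<theta> k)))"
  have "sin (pi / n) > 0" using n by (intro sin_gt_zero) (auto simp: field_simps)
  then have c: "c > 0" "c * (4 / (sin (pi / n))\<^sup>2) = 1" by (simp_all add: c_def)
  have A: "A \<in> symmetric_mats n"
    by (auto simp: symmetric_mats_def A_def cos_diff mult.commute intro!: eq_matI)
  have "cmod (\<Sum>j<n. \<Sum>k<n. A $$ (j, k) * z $ j * z $ k) \<le> 1" if z: "z \<in> polydisc n" for z
  proof -
    have "(\<Sum>j<n. \<Sum>k<n. A $$ (j, k) * z $ j * z $ k) =
        c * (\<Sum>j<n. \<Sum>k<n. cos (\<theta> j - \<theta> k) * z $ j * z $ k)"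
      unfolding sum_distrib_left by (intro sum.cong refl) (simp add: A_def mult.assoc)
    also have "cmod \<dots> \<le> c * (4 / (sin (pi / n))\<^sup>2)"
    proof -
      have "cmod (\<Sum>j<n. \<Sum>k<n. cos (\<theta> j - \<theta> k) * z $ j * z $ k) \<le> 4 / (sin (pi / n))\<^sup>2"
        unfolding \<theta>_def using n z by (intro cosine_form_le) (auto simp: polydisc_def less_imp_le)
      then show ?thesis using c(1) by (simp add: norm_mult mult_left_mono del: times_divide_eq_right)
    qed
    finally show ?thesis unfolding c(2) .
  qed
  then have "cmod (\<Sum>j<n. \<Sum>k<n. A $$ (j, k) * cis (- \<theta> k) * cnj (cis (- \<theta> j))) \<le> sym_coeff_norm n"
    by (rule bilinear_form_le_sym_coeff_norm[OF A]) simp_all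
  also have "(\<Sum>j<n. \<Sum>k<n. A $$ (j, k) * cis (- \<theta> k) * cnj (cis (- \<theta> j))) =
      c * (\<Sum>j<n. \<Sum>k<n. cos (\<theta> j - \<theta> k) * cis (- \<theta> k) * cis (\<theta> j))"
    unfolding sum_distrib_left by (intro sum.cong refl) (simp add: A_def mult.assoc cis_cnj)
  also have "\<dots> = complex_of_real (c * ((real n)\<^sup>2 / 2))"
    using cosine_bilinear_value[OF n] by (simp add: \<theta>_def)
  also have "cmod \<dots> = c * ((real n)\<^sup>2 / 2)" using c(1) by (simp only: norm_of_real) simp
  finally show ?thesis by (simp add: c_def power_mult_distrib mult.commute)
qed

theorem theorem2p8:
  shows "convergent sym_coeff_norm \<and> lim sym_coeff_norm \<ge> pi\<^sup>2 / 8"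
proof
  show conv: "convergent sym_coeff_norm" by (rule convergent_sym_coeff_norm)
  have "(\<lambda>n. (real n * sin (pi / n))\<^sup>2 / 8) \<longlonglongrightarrow> pi\<^sup>2 / 8"
    by real_asymp
  moreover have "sym_coeff_norm \<longlonglongrightarrow> lim sym_coeff_norm"
    using conv by (simp add: convergent_LIMSEQ_iff)
  ultimately show "pi\<^sup>2 / 8 \<le> lim sym_coeff_norm"
    by (rule LIMSEQ_le) (use sym_coeff_norm_ge in blast)
qed

end
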